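(* Let $s\ge 2$ be an integer, let $a$ be a real number, and let $G$ be a graph on at least two vertices with a dominating vertex $v$ (a vertex adjacent to all other vertices of $G$). Then $G-v$ is $(\mathrm{gn}_s\ge a)$-saturated if and only if $G$ is $(\mathrm{gn}_s\ge a+1)$-saturated.
   Context: All graphs are finite, simple and undirected; $G-v$ is the graph obtained by deleting the vertex $v$. Guessing number: for an integer $s\ge 2$ and a graph $G$ with vertices $v_1,\dots,v_n$, a protocol is a family $\mathcal P=\{f_i\}_{i=1}^n$ of functions $f_i:\mathbb Z_s^n\to\mathbb Z_s$ such that $f_i(c)$ depends only on the coordinates of $c$ indexed by the neighbors of $v_i$ (not on $v_i$ itself). View $\mathcal P$ as a map $\mathbb Z_s^n\to\mathbb Z_s^n$, $c\mapsto(f_1(c),\dots,f_n(c))$, and let $\mathrm{fix}(\mathcal P)$ be the number of its fixed points. Then $\mathrm{gn}_s(G)=\log_s\max_{\mathcal P}\mathrm{fix}(\mathcal P)$. For real $t$, a graph $G$ is $(\mathrm{gn}_s\ge t)$-saturated if $\mathrm{gn}_s(G)<t$ and $\mathrm{gn}_s(G+e)\ge t$ for every non-edge $e$ of $G$ (a pair of distinct non-adjacent vertices of $G$). *)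

theory Defs
  imports Complex_Main "HOL-Library.FuncSet" "Graph_Theory.Pair_Digraph"
begin

text \<open>
  Finite simple undirected graphs are the \<^locale>\<open>pair_graph\<close>s: finite, loop-free digraphs without
  parallel arcs whose arc relation is symmetric. An undirected edge between x and y is the pair of
  arcs (x, y) and (y, x).
\<close>

definition neighbors :: "'a pair_pre_digraph \<Rightarrow> 'a \<Rightarrow> 'a set" where
  "neighbors G x = {y. (x, y) \<in> parcs G}"

definition dominating_vertex :: "'a pair_pre_digraph \<Rightarrow> 'a \<Rightarrow> bool" where
  "dominating_vertex G v \<longleftrightarrow> v \<in> pverts G \<and> (\<forall>u \<in> pverts G - {v}. u \<in> neighbors G v)"

definition delete_vertex :: "'a pair_pre_digraph \<Rightarrow> 'a \<Rightarrow> 'a pair_pre_digraph" where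
  "delete_vertex G v =
     \<lparr>pverts = pverts G - {v}, parcs = {e \<in> parcs G. fst e \<noteq> v \<and> snd e \<noteq> v}\<rparr>"

lemma with_proj_delete_vertex:
  "with_proj (delete_vertex G v) = pre_digraph.del_vert (with_proj G) v"
  by (simp add: delete_vertex_def pre_digraph.del_vert_def with_proj_def)

lemma pair_graph_delete_vertex:
  assumes "pair_graph G"
  shows "pair_graph (delete_vertex G v)"
proof -
  interpret pair_graph G by fact
  have "sym (parcs G)"
    using pair_sym_arcs by (simp add: symmetric_def)
  then have "symmetric (with_proj (delete_vertex G v))"
    by (auto simp: symmetric_def delete_vertex_def sym_def)
  then show ?thesis
    by unfold_locales
      (auto simp: delete_vertex_def pair_finite_verts pair_finite_arcs
            dest: arc_fst_in_verts arc_snd_in_verts pair_no_loops)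
qed

definition non_edge :: "'a pair_pre_digraph \<Rightarrow> 'a \<Rightarrow> 'a \<Rightarrow> bool" where
  "non_edge G x y \<longleftrightarrow> x \<in> pverts G \<and> y \<in> pverts G \<and> x \<noteq> y \<and> y \<notin> neighbors G x"

definition add_edge :: "'a pair_pre_digraph \<Rightarrow> 'a \<Rightarrow> 'a \<Rightarrow> 'a pair_pre_digraph" where
  "add_edge G x y = \<lparr>pverts = pverts G, parcs = parcs G \<union> {(x, y), (y, x)}\<rparr>"

lemma pair_graph_add_edge:
  assumes "pair_graph G" "non_edge G x y"
  shows "pair_graph (add_edge G x y)"
proof -
  interpret pair_graph G by fact
  have "sym (parcs G)"
    using pair_sym_arcs by (simp add: symmetric_def)
  then have "symmetric (with_proj (add_edge G x y))"
    by (auto simp: symmetric_def add_edge_def sym_def)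
  then show ?thesis
    using assms(2)
    by unfold_locales
      (auto simp: add_edge_def non_edge_def pair_finite_verts pair_finite_arcs
            dest: arc_fst_in_verts arc_snd_in_verts pair_no_loops)
qed

text \<open>
  Coordinates are indexed by the vertices themselves instead of by 1, ..., n. Only the set
  underlying the integers modulo s matters here, and it is represented by {..<s}.
\<close>

definition configs :: "nat \<Rightarrow> 'a pair_pre_digraph \<Rightarrow> ('a \<Rightarrow> nat) set" where
  "configs s G = (pverts G \<rightarrow>\<^sub>E {..<s})"

definition protocol :: "nat \<Rightarrow> 'a pair_pre_digraph \<Rightarrow> ('a \<Rightarrow> ('a \<Rightarrow> nat) \<Rightarrow> nat) \<Rightarrow> bool" where
  "protocol s G P \<longleftrightarrow>
     (\<forall>x \<in> pverts G. P x \<in> configs s G \<rightarrow> {..<s} \<and>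
        (\<forall>c \<in> configs s G. \<forall>d \<in> configs s G. (\<forall>y \<in> neighbors G x. c y = d y) \<longrightarrow> P x c = P x d))"

definition protocol_map ::
    "'a pair_pre_digraph \<Rightarrow> ('a \<Rightarrow> ('a \<Rightarrow> nat) \<Rightarrow> nat) \<Rightarrow> ('a \<Rightarrow> nat) \<Rightarrow> ('a \<Rightarrow> nat)" where
  "protocol_map G P c = (\<lambda>x \<in> pverts G. P x c)"

definition num_fix :: "nat \<Rightarrow> 'a pair_pre_digraph \<Rightarrow> ('a \<Rightarrow> ('a \<Rightarrow> nat) \<Rightarrow> nat) \<Rightarrow> nat" where
  "num_fix s G P = card {c \<in> configs s G. protocol_map G P c = c}"

definition guessing_number :: "nat \<Rightarrow> 'a pair_pre_digraph \<Rightarrow> real" where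
  "guessing_number s G = log (real s) (real (Max {num_fix s G P | P. protocol s G P}))"

text \<open>The maximum is taken over a finite nonempty set.\<close>

lemma finite_num_fix:
  assumes "finite (pverts G)"
  shows "finite {num_fix s G P | P. protocol s G P}"
proof (rule finite_subset)
  have "finite (configs s G)"
    unfolding configs_def using assms by (intro finite_PiE) auto
  then show "{num_fix s G P | P. protocol s G P} \<subseteq> {..card (configs s G)}"
    unfolding num_fix_def by (auto intro!: card_mono)
qed simp

lemma num_fix_nonempty:
  assumes "s > 0"
  shows "{num_fix s G P | P. protocol s G P} \<noteq> {}"
proof -
  have "protocol s G (\<lambda>_ _. 0)"
    using assms by (auto simp: protocol_def)
  then show ?thesis by blast
qed

definition gn_saturated :: "nat \<Rightarrow> real \<Rightarrow> 'a pair_pre_digraph \<Rightarrow> bool" where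
  "gn_saturated s t G \<longleftrightarrow>
     guessing_number s G < t \<and>
     (\<forall>x y. non_edge G x y \<longrightarrow> guessing_number s (add_edge G x y) \<ge> t)"

end

theory Submission
  imports Defs
begin

text \<open>
  Deleting a dominating vertex v divides the maximal number of fixed points by exactly s, that is,
  lowers the guessing number by 1. Fixing the most popular value at v turns a protocol on G into one
  on G - v with at least an s-th of the fixed points. Conversely, let F be the set of fixed points
  of a protocol on G - v and u a vertex of G - v. Two elements of F never differ in u alone, since
  the guess at u does not see u; so the s translates of F in the direction of u are pairwise
  disjoint, v can tell from the other coordinates in which translate they lie, and the others can
  read the translate off the value at v. As non-edges of G avoid v, this applies to every G + e.
\<close>

section \<open>Maximal number of fixed points\<close>

definition max_fix :: "nat \<Rightarrow> 'a pair_pre_digraph \<Rightarrow> nat" where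
  "max_fix s G = Max {num_fix s G P | P. protocol s G P}"

lemma protocol_less:
  assumes "protocol s G P" "x \<in> pverts G" "c \<in> configs s G"
  shows "P x c < s"
  using funcset_mem[OF conjunct1[OF bspec[OF assms(1)[unfolded protocol_def] assms(2)]] assms(3)]
  by simp

lemma protocol_cong:
  assumes "protocol s G P" "x \<in> pverts G" "c \<in> configs s G" "d \<in> configs s G"
    and "\<forall>y \<in> neighbors G x. c y = d y"
  shows "P x c = P x d"
  using bspec[OF bspec[OF conjunct2[OF bspec[OF assms(1)[unfolded protocol_def] assms(2)]]
        assms(3)] assms(4)] assms(5)
  by (rule mp)

lemma num_fix_le_max_fix:
  assumes "finite (pverts G)" "protocol s G P"
  shows "num_fix s G P \<le> max_fix s G"
  unfolding max_fix_def using assms finite_num_fix by (intro Max_ge) auto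

lemma max_fix_attained:
  assumes "finite (pverts G)" "s > 0"
  obtains P where "protocol s G P" "num_fix s G P = max_fix s G"
proof -
  have "max_fix s G \<in> {num_fix s G P | P. protocol s G P}"
    unfolding max_fix_def using assms by (intro Max_in finite_num_fix num_fix_nonempty)
  then show ?thesis
    using that by auto
qed

lemma finite_configs:
  assumes "finite (pverts G)"
  shows "finite (configs s G)"
  unfolding configs_def using assms by (intro finite_PiE) auto

text \<open>Outside the vertex set both functions are \<open>undefined\<close>, so comparing them at
  the vertices is enough.\<close>

lemma fixed_point_iff:
  assumes "c \<in> configs s G"
  shows "protocol_map G P c = c \<longleftrightarrow> (\<forall>x \<in> pverts G. P x c = c x)"
  using assms unfolding configs_def protocol_map_def
  by (auto simp: fun_eq_iff PiE_def extensional_def restrict_def)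

text \<open>The all-zero protocol fixes the all-zero configuration. Positivity is what lets the
  logarithm of a product be split later.\<close>

lemma max_fix_pos:
  assumes "finite (pverts G)" "s > 0"
  shows "max_fix s G > 0"
proof -
  let ?c = "\<lambda>x \<in> pverts G. 0 :: nat"
  have "protocol s G (\<lambda>_ _. 0)"
    using assms by (auto simp: protocol_def)
  then have le: "num_fix s G (\<lambda>_ _. 0) \<le> max_fix s G"
    using assms by (intro num_fix_le_max_fix)
  have "?c \<in> configs s G"
    using assms by (auto simp: configs_def)
  then have "?c \<in> {c \<in> configs s G. protocol_map G (\<lambda>_ _. 0) c = c}"
    by (simp add: fixed_point_iff)
  then have "num_fix s G (\<lambda>_ _. 0) > 0"
    unfolding num_fix_def using finite_configs[OF assms(1)] by (subst card_gt_0_iff) auto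
  with le show ?thesis by simp
qed

section \<open>Upper bound: freezing the value at the deleted vertex\<close>

lemma pverts_delete_vertex [simp]: "pverts (delete_vertex G v) = pverts G - {v}"
  by (simp add: delete_vertex_def)

lemma neighbors_delete_vertex:
  "x \<noteq> v \<Longrightarrow> neighbors (delete_vertex G v) x = neighbors G x - {v}"
  by (auto simp: neighbors_def delete_vertex_def)

lemma config_fun_upd:
  assumes "x \<in> configs s (delete_vertex G v)" "v \<in> pverts G" "k < s"
  shows "x(v := k) \<in> configs s G"
  using assms by (auto simp: configs_def PiE_iff extensional_def)

lemma max_fix_le_delete_vertex:
  assumes "finite (pverts G)" "s > 0" "v \<in> pverts G"
  shows "max_fix s G \<le> s * max_fix s (delete_vertex G v)"
proof -
  let ?H = "delete_vertex G v"
  obtain P where P: "protocol s G P" "num_fix s G P = max_fix s G"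
    using max_fix_attained[OF assms(1,2)] .
  note P_less = protocol_less[OF P(1)] and P_cong = protocol_cong[OF P(1)]
  \<comment> \<open>All values \<open>k\<close> are treated alike: the fixed points with value
    \<open>k\<close> at \<open>v\<close> are counted by a protocol on \<open>G - v\<close> that
    pretends \<open>v\<close> has value \<open>k\<close>, and the \<open>s\<close> bounds are
    summed.\<close>
  define Q where "Q k x c = P x (c(v := k))" for k :: nat and x and c
  define A where "A k = {c \<in> configs s G. protocol_map G P c = c \<and> c v = k}" for k
  have card_A: "card (A k) \<le> max_fix s ?H" if k: "k < s" for k
  proof -
    have upd: "c(v := k) \<in> configs s G" if "c \<in> configs s ?H" for c
      using that assms(3) k by (rule config_fun_upd)
    have "protocol s ?H (Q k)"
      unfolding protocol_def
    proof (intro ballI conjI impI)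
      fix x assume "x \<in> pverts ?H"
      then have x: "x \<in> pverts G" "x \<noteq> v" by auto
      show "Q k x \<in> configs s ?H \<rightarrow> {..<s}"
        using P_less x(1) upd by (auto simp: Q_def)
      fix c d assume c: "c \<in> configs s ?H" "d \<in> configs s ?H" "\<forall>y\<in>neighbors ?H x. c y = d y"
      then have "\<forall>y\<in>neighbors G x. (c(v := k)) y = (d(v := k)) y"
        using x by (auto simp: neighbors_delete_vertex)
      then show "Q k x c = Q k x d"
        unfolding Q_def by (rule P_cong[OF x(1) upd[OF c(1)] upd[OF c(2)]])
    qed
    then have le: "num_fix s ?H (Q k) \<le> max_fix s ?H"
      using assms by (intro num_fix_le_max_fix) auto
    \<comment> \<open>Nothing is lost by forgetting a coordinate known to be \<open>k\<close>. This
      yields both injectivity and the fact that \<open>Q k\<close> guesses on the restriction of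
      \<open>c\<close> as \<open>P\<close> does on \<open>c\<close>.\<close>
    have upd_restrict: "(restrict c (pverts ?H))(v := k) = c" if "c \<in> A k" for c
      using that by (auto simp: A_def configs_def PiE_iff extensional_def fun_eq_iff)
    have "card (A k) \<le> num_fix s ?H (Q k)"
      unfolding num_fix_def
    proof (rule card_inj_on_le)
      show "inj_on (\<lambda>c. restrict c (pverts ?H)) (A k)"
        by (rule inj_on_inverseI[where g = "\<lambda>c. c(v := k)"]) (rule upd_restrict)
      show "(\<lambda>c. restrict c (pverts ?H)) ` A k \<subseteq> {c \<in> configs s ?H. protocol_map ?H (Q k) c = c}"
      proof safe
        fix c assume c: "c \<in> A k"
        then show r: "restrict c (pverts ?H) \<in> configs s ?H"
          by (auto simp: A_def configs_def)
        from c have "\<forall>x \<in> pverts G. P x c = c x"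
          by (auto simp: A_def fixed_point_iff)
        then show "protocol_map ?H (Q k) (restrict c (pverts ?H)) = restrict c (pverts ?H)"
          using upd_restrict[OF c] by (subst fixed_point_iff[OF r]) (auto simp: Q_def)
      qed
      show "finite {c \<in> configs s ?H. protocol_map ?H (Q k) c = c}"
        using finite_configs[of ?H s] assms(1) by simp
    qed
    with le show ?thesis by simp
  qed
  have "{c \<in> configs s G. protocol_map G P c = c} = (\<Union>k<s. A k)"
    using assms(3) by (auto simp: A_def configs_def)
  then have "max_fix s G = card (\<Union>k<s. A k)"
    using P(2) by (simp add: num_fix_def)
  also have "\<dots> \<le> (\<Sum>k<s. card (A k))"
    by (rule card_UN_le) simp
  also have "\<dots> \<le> (\<Sum>k<s. max_fix s ?H)"
    using card_A by (intro sum_mono) simp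
  finally show ?thesis by simp
qed

section \<open>Lower bound: translating fixed points\<close>

lemma mod_add_diff_cancel:
  fixes m k s :: nat
  assumes "m < s" "k < s"
  shows "((m + k) mod s + (s - k)) mod s = m"
proof -
  have "((m + k) mod s + (s - k)) mod s = (m + k + (s - k)) mod s"
    by (rule mod_add_left_eq)
  also have "m + k + (s - k) = m + s"
    using assms(2) by simp
  finally show ?thesis
    using assms(1) by simp
qed

text \<open>Dominance serves in both directions: \<open>v\<close> sees all other coordinates and can
  compute the translate, and by symmetry every other vertex sees \<open>v\<close> and can undo
  it.\<close>

lemma max_fix_ge_delete_dominating_vertex:
  assumes "pair_graph G" "s > 0" "dominating_vertex G v" "u \<in> pverts G" "u \<noteq> v"
  shows "s * max_fix s (delete_vertex G v) \<le> max_fix s G"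
proof -
  interpret pair_graph G by fact
  let ?H = "delete_vertex G v"
  have fin: "finite (pverts G)" by (rule pair_finite_verts)
  have v: "v \<in> pverts G" and vN: "\<And>x. x \<in> pverts G \<Longrightarrow> x \<noteq> v \<Longrightarrow> x \<in> neighbors G v"
    using assms(3) by (auto simp: dominating_vertex_def)
  have Nv: "v \<in> neighbors G x" if "x \<in> pverts G" "x \<noteq> v" for x
    using vN[OF that] pair_sym_arcs by (auto simp: neighbors_def symmetric_def sym_def)
  have irr: "u \<notin> neighbors ?H u"
    using pair_no_loops[of "(u, u)"] by (auto simp: neighbors_def delete_vertex_def)
  have NV: "y \<in> pverts ?H" if "y \<in> neighbors ?H x" for x y
    using that arc_snd_in_verts[of "(x, y)"] by (auto simp: neighbors_def delete_vertex_def)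
  obtain P where P: "protocol s ?H P" "num_fix s ?H P = max_fix s ?H"
    by (rule max_fix_attained[of ?H s]) (use fin assms(2) in auto)
  note P_less = protocol_less[OF P(1)] and P_cong = protocol_cong[OF P(1)]
  \<comment> \<open>The shift stored at \<open>v\<close> is subtracted at \<open>u\<close>, and
    \<open>v\<close> is forgotten. On configurations \<open>c v < s\<close>, so
    \<open>s - c v\<close> is not truncated and represents the negative of \<open>c v\<close> modulo
    \<open>s\<close>.\<close>
  define \<sigma> where "\<sigma> c = restrict (c(u := (c u + (s - c v)) mod s)) (pverts ?H)" for c :: "'a \<Rightarrow> nat"
  \<comment> \<open>On a translate of a fixed point, \<open>c u\<close> differs from the original
    guess at \<open>u\<close> by exactly the shift: \<open>v\<close> recovers the shift as this
    difference, while \<open>u\<close> reads it at \<open>v\<close> and adds it.\<close>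
  define Q where "Q x c =
      (if x = v then (c u + (s - P u (\<sigma> c))) mod s
       else if x = u then (P u (\<sigma> c) + c v) mod s
       else P x (\<sigma> c))" for x c
  have \<sigma>_config: "\<sigma> c \<in> configs s ?H" if "c \<in> configs s G" for c
    using that assms(2) by (auto simp: \<sigma>_def configs_def PiE_iff)
  have "protocol s G Q"
    unfolding protocol_def
  proof (intro ballI conjI impI)
    fix x assume x: "x \<in> pverts G"
    show "Q x \<in> configs s G \<rightarrow> {..<s}"
      using x P_less \<sigma>_config assms(2) by (auto simp: Q_def)
    fix c d
    assume c: "c \<in> configs s G" and d: "d \<in> configs s G"
      and eq: "\<forall>y\<in>neighbors G x. c y = d y"
    note cong = P_cong[OF _ \<sigma>_config[OF c] \<sigma>_config[OF d]]
    show "Q x c = Q x d"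
    proof (cases "x = v")
      case True
      then have "c y = d y" if "y \<in> pverts G" "y \<noteq> v" for y
        using eq vN that by blast
      \<comment> \<open>Here \<open>c v\<close> and \<open>d v\<close> may differ, so
        \<open>\<sigma> c\<close> and \<open>\<sigma> d\<close> may differ at \<open>u\<close>; but
        the guess at \<open>u\<close> ignores that coordinate.\<close>
      then have "\<forall>y\<in>neighbors ?H u. \<sigma> c y = \<sigma> d y" "c u = d u"
        using NV irr assms(4,5) by (auto simp: \<sigma>_def)
      then show ?thesis
        using True assms(4,5) cong[of u] by (simp add: Q_def)
    next
      case False
      then have cv: "c v = d v"
        using eq Nv x by blast
      \<comment> \<open>Both configurations are shifted back by the same amount, so agreement
        survives even if \<open>u\<close> is a neighbor of \<open>x\<close>.\<close>
      have "\<forall>y\<in>neighbors ?H x. \<sigma> c y = \<sigma> d y"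
        using eq cv NV False by (auto simp: \<sigma>_def neighbors_delete_vertex)
      then have "P x (\<sigma> c) = P x (\<sigma> d)"
        using cong x False by simp
      then show ?thesis
        using False cv by (cases "x = u") (simp_all add: Q_def)
    qed
  qed
  then have le: "num_fix s G Q \<le> max_fix s G"
    using fin by (intro num_fix_le_max_fix)
  define F where "F = {c \<in> configs s ?H. protocol_map ?H P c = c}"
  \<comment> \<open>The translate of \<open>x\<close> by \<open>k\<close>, with the shift recorded
    at \<open>v\<close>.\<close>
  define \<phi> where "\<phi> = (\<lambda>(x, k). x(u := (x u + k) mod s, v := k))"
  have \<sigma>_\<phi>: "\<sigma> (\<phi> (x, k)) = x" if x: "x \<in> configs s ?H" and k: "k < s" for x k
  proof -
    have "x u < s"
      using x assms(4,5) by (auto simp: configs_def)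
    then have "((x u + k) mod s + (s - k)) mod s = x u"
      using k by (rule mod_add_diff_cancel)
    then show ?thesis
      using x assms(4,5)
      by (auto simp: \<sigma>_def \<phi>_def configs_def PiE_iff extensional_def fun_eq_iff)
  qed
  have \<phi>_config: "\<phi> (x, k) \<in> configs s G" if "x \<in> configs s ?H" "k < s" for x k
    using that v assms(2,4,5) by (auto simp: \<phi>_def configs_def PiE_iff extensional_def)
  have "card (F \<times> {..<s}) \<le> num_fix s G Q"
    unfolding num_fix_def
  proof (rule card_inj_on_le)
    show "inj_on \<phi> (F \<times> {..<s})"
    proof (rule inj_onI)
      fix p q assume p: "p \<in> F \<times> {..<s}" and q: "q \<in> F \<times> {..<s}" and eq: "\<phi> p = \<phi> q"
      \<comment> \<open>The value at \<open>v\<close> returns the shift, and \<open>\<sigma>\<close>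
        returns the fixed point.\<close>
      have "\<phi> p v = \<phi> q v" "\<sigma> (\<phi> p) = \<sigma> (\<phi> q)"
        using eq by simp_all
      then show "p = q"
        using p q by (auto simp: F_def \<sigma>_\<phi>) (auto simp: \<phi>_def)
    qed
    show "\<phi> ` (F \<times> {..<s}) \<subseteq> {c \<in> configs s G. protocol_map G Q c = c}"
    proof (rule image_subsetI)
      fix p assume "p \<in> F \<times> {..<s}"
      then obtain x k where p: "p = (x, k)" and x: "x \<in> configs s ?H" and k: "k < s"
        and fix_x: "\<forall>y \<in> pverts ?H. P y x = x y"
        by (auto simp: F_def fixed_point_iff)
      have xu: "x u < s"
        using x assms(4,5) by (auto simp: configs_def)
      \<comment> \<open>This is the guess of \<open>v\<close> at the translate, since
        \<open>P u x = x u\<close>; the cancellation rule is applied with \<open>k\<close> and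
        \<open>x u\<close> exchanging roles.\<close>
      then have "((x u + k) mod s + (s - x u)) mod s = k"
        using mod_add_diff_cancel[OF k] by (subst add.commute[of "x u" k])
      then have "protocol_map G Q (\<phi> (x, k)) = \<phi> (x, k)"
        using fix_x \<sigma>_\<phi>[OF x k] assms(4,5)
        by (subst fixed_point_iff[OF \<phi>_config[OF x k]]) (auto simp: Q_def \<phi>_def)
      then show "\<phi> p \<in> {c \<in> configs s G. protocol_map G Q c = c}"
        using \<phi>_config[OF x k] p by simp
    qed
    show "finite {c \<in> configs s G. protocol_map G Q c = c}"
      using finite_configs[OF fin] by simp
  qed
  moreover have "card F = max_fix s ?H"
    using P(2) by (simp add: F_def num_fix_def)
  ultimately show ?thesis
    using le by (simp add: card_cartesian_product mult.commute)
qed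

section \<open>Guessing numbers and saturation\<close>

lemma guessing_number_delete_dominating_vertex:
  assumes "pair_graph G" "s \<ge> 2" "card (pverts G) \<ge> 2" "dominating_vertex G v"
  shows "guessing_number s G = guessing_number s (delete_vertex G v) + 1"
proof -
  let ?H = "delete_vertex G v"
  interpret pair_graph G by fact
  have fin: "finite (pverts G)" by (rule pair_finite_verts)
  have v: "v \<in> pverts G"
    using assms(4) by (simp add: dominating_vertex_def)
  have "\<not> pverts G \<subseteq> {v}"
    using assms(3) card_mono[of "{v}" "pverts G"] by auto
  then obtain u where "u \<in> pverts G" "u \<noteq> v"
    by blast
  then have "s * max_fix s ?H \<le> max_fix s G"
    using assms by (intro max_fix_ge_delete_dominating_vertex) auto
  moreover have "max_fix s G \<le> s * max_fix s ?H"
    using fin v assms(2) by (intro max_fix_le_delete_vertex) auto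
  ultimately have "max_fix s G = s * max_fix s ?H"
    by simp
  moreover have "max_fix s ?H > 0"
    using fin assms(2) by (intro max_fix_pos) auto
  ultimately show ?thesis
    using assms(2) by (simp add: guessing_number_def max_fix_def[symmetric] log_mult_pos)
qed

text \<open>No non-edge of \<open>G\<close> meets \<open>v\<close>; symmetry of the arcs covers the
  case that \<open>v\<close> is the second endpoint.\<close>

lemma non_edge_delete_dominating_vertex:
  assumes "pair_graph G" "dominating_vertex G v"
  shows "non_edge (delete_vertex G v) x y \<longleftrightarrow> non_edge G x y"
proof -
  interpret pair_graph G by fact
  have "sym (parcs G)"
    using pair_sym_arcs by (simp add: symmetric_def)
  then show ?thesis
    using assms(2)
    by (auto simp: non_edge_def dominating_vertex_def neighbors_def delete_vertex_def dest: symD)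
qed

lemma add_edge_delete_vertex:
  assumes "x \<noteq> v" "y \<noteq> v"
  shows "add_edge (delete_vertex G v) x y = delete_vertex (add_edge G x y) v"
  using assms by (auto simp: add_edge_def delete_vertex_def)

lemma dominating_vertex_add_edge:
  "dominating_vertex G v \<Longrightarrow> dominating_vertex (add_edge G x y) v"
  by (auto simp: dominating_vertex_def add_edge_def neighbors_def)

theorem corollary5p1p1:
  fixes s :: nat and a :: real and G :: "'a pair_pre_digraph" and v :: 'a
  assumes "s \<ge> 2"
    and "pair_graph G"
    and "card (pverts G) \<ge> 2"
    and "dominating_vertex G v"
  shows "gn_saturated s a (delete_vertex G v) \<longleftrightarrow> gn_saturated s (a + 1) G"
proof -
  \<comment> \<open>\<open>v\<close> still dominates after the edge is added, and the edge avoids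
    \<open>v\<close>, so adding it commutes with deleting \<open>v\<close> and the difference of 1
    persists.\<close>
  have add: "guessing_number s (add_edge G x y) =
      guessing_number s (add_edge (delete_vertex G v) x y) + 1" if "non_edge G x y" for x y
  proof -
    have "non_edge (delete_vertex G v) x y"
      using that assms by (simp add: non_edge_delete_dominating_vertex)
    then have "x \<noteq> v" "y \<noteq> v"
      by (auto simp: non_edge_def)
    moreover have "card (pverts (add_edge G x y)) \<ge> 2"
      using assms(3) by (simp add: add_edge_def)
    ultimately show ?thesis
      using guessing_number_delete_dominating_vertex[OF pair_graph_add_edge[OF assms(2) that]
          assms(1) _ dominating_vertex_add_edge[OF assms(4)]]
      by (simp add: add_edge_delete_vertex)
  qed
  show ?thesis
    using guessing_number_delete_dominating_vertex[OF assms(2,1,3,4)] add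
    by (auto simp: gn_saturated_def non_edge_delete_dominating_vertex[OF assms(2,4)])
qed

end
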